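(* Let $m$ be an odd positive integer, let $Y$ be a skew-symmetric matrix of size $m$, and let $M=(a_ib_j)_{1\le i,j\le m}$ be a rank-$1$ matrix of the same size. Then $$\det(Y+M)=\Bigg(\sum_{i=1}^m(-1)^{i-1}a_i\operatorname{Pf}(Y(i))\Bigg)\Bigg(\sum_{j=1}^m(-1)^{j-1}b_j\operatorname{Pf}(Y(j))\Bigg),$$ where $Y(i)$ arises from $Y$ by deleting the $i$-th row and the $i$-th column.
   Context: Entries lie in a commutative ring with unit; skew-symmetric means $Y^t=-Y$ with zero diagonal. "Rank-$1$ matrix" simply means a matrix of the form $(a_ib_j)$ for elements $a_1,\dots,a_m,b_1,\dots,b_m$. For a skew-symmetric matrix $Z$ of even size $p$, the Pfaffian is $\operatorname{Pf}(Z)=\sum_{\mu}\operatorname{sgn}\mu\prod_{\{i,j\}\in\mu,\ i<j}Z_{i,j}$, the sum being over all perfect matchings $\mu$ of $\{1,\dots,p\}$, where $\operatorname{sgn}\mu=(-1)^{\mathrm{cr}(\mu)}$ and $\mathrm{cr}(\mu)$ is the number of quadruples $i<j<k<l$ such that $\{i,k\}$ and $\{j,l\}$ are pairs in $\mu$. The Pfaffian of the empty ($0\times 0$) matrix is $1$. *)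

theory Defs
  imports Jordan_Normal_Form.Determinant
begin

(* Indices are 0-based throughout: the rows and columns of an n x n matrix are 0, ..., n - 1.
   The zero diagonal is a separate condition because 2 may be a zero divisor. *)
definition skew_symmetric_mat :: "'a :: comm_ring_1 mat \<Rightarrow> bool" where
  "skew_symmetric_mat Y \<longleftrightarrow>
     square_mat Y \<and> transpose_mat Y = - Y \<and> (\<forall>i < dim_row Y. Y $$ (i, i) = 0)"

definition perfect_matchings :: "nat \<Rightarrow> nat set set set" where
  "perfect_matchings p = {\<mu>. partition_on {0..<p} \<mu> \<and> (\<forall>e\<in>\<mu>. card e = 2)}"

definition crossings :: "nat set set \<Rightarrow> nat" where
  "crossings \<mu> =
     card {(i, j, k, l). i < j \<and> j < k \<and> k < l \<and> {i, k} \<in> \<mu> \<and> {j, l} \<in> \<mu>}"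

(* Each pair e = {i, j} of a matching contributes the entry in row Min e and column Max e.
   The Pfaffian is only meant for skew-symmetric matrices of even size
   (for odd size there is no perfect matching, so the value is 0). *)
definition pfaffian :: "'a :: comm_ring_1 mat \<Rightarrow> 'a" where
  "pfaffian Z =
     (\<Sum>\<mu>\<in>perfect_matchings (dim_row Z).
        (- 1) ^ crossings \<mu> * (\<Prod>e\<in>\<mu>. Z $$ (Min e, Max e)))"

end

theory Submission
  imports Defs
begin

text \<open>By bordering, \<open>det (Y + a b\<^sup>t)\<close> is the determinant of the matrix of size \<open>m + 1\<close> with blocks
\<open>Y\<close>, \<open>-a\<close>, \<open>b\<^sup>t\<close> and \<open>1\<close>. If \<open>Y\<close> is enlarged to an alternating matrix \<open>y\<close> with two more
indices, whose rows are \<open>a\<close> and \<open>b\<close>, this is a minor of \<open>y\<close>: its row set and its column set both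
contain the indices of \<open>Y\<close> and one index more, the \<open>b\<close>-index for the rows and the \<open>a\<close>-index for
the columns. The theorem is therefore an instance of a statement on almost principal minors of an
alternating matrix (\<open>odd_minor_alternating\<close>, essentially due to Cayley): for \<open>T\<close> of odd size, the
minor with rows \<open>T \<union> {r}\<close> and columns \<open>T \<union> {c}\<close> is the product of a factor that depends on
\<open>r\<close> and the same factor for \<open>c\<close>. That factor is, up to sign, the Pfaffian on \<open>T \<union> {r}\<close>,
expanded along row \<open>r\<close>.

The minors of this kind are closed under double expansion: expanding along row \<open>r\<close> and then column
\<open>c\<close> leaves the principal minors on \<open>T\<close> and on \<open>T - {j}\<close>, and the minors with rows \<open>T - {i}\<close>
and columns \<open>T - {j}\<close>, which are almost principal over \<open>T - {i, j}\<close> (\<open>minor_expansion\<close>). The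
principal minor on \<open>T\<close> vanishes, since its size is odd (\<open>det_on_alternating_odd\<close>). To the others
the induction hypothesis applies, and it yields products of the Pfaffians on \<open>T - {i}\<close> and
\<open>T - {j}\<close>, because a Pfaffian can be expanded along any row (\<open>pf_on_expansion\<close>). The double sum
then factors. Every step is an identity between sums and products of entries, so the argument is
valid over every commutative ring, also in characteristic two.

Deleting rows and columns repeatedly would make the bookkeeping of positions the main burden.
Determinants and Pfaffians are therefore taken over arbitrary finite index sets, so that deletion
is set difference; the only relabelling is the one that turns the Pfaffian of a matrix with a
deleted row and column into a Pfaffian over an index set.\<close>

section \<open>Determinants over an index set\<close>

definition det_on :: "'b set \<Rightarrow> ('b \<Rightarrow> 'b \<Rightarrow> 'a :: comm_ring_1) \<Rightarrow> 'a" where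
  "det_on S f = (\<Sum>p | p permutes S. of_int (sign p) * (\<Prod>i\<in>S. f i (p i)))"

lemma det_on_empty [simp]: "det_on {} f = 1"
  by (simp add: det_on_def)

lemma det_on_cong:
  assumes "\<And>i j. i \<in> S \<Longrightarrow> j \<in> S \<Longrightarrow> f i j = g i j"
  shows "det_on S f = det_on S g"
  unfolding det_on_def
  by (intro sum.cong refl arg_cong2[where f = "(*)"] prod.cong)
     (auto simp: assms permutes_in_image)

lemma det_on_transpose:
  assumes "finite S"
  shows "det_on S (\<lambda>i j. f j i) = det_on S f"
proof -
  have "det_on S f = (\<Sum>p | p permutes S. of_int (sign (Hilbert_Choice.inv p)) * (\<Prod>i\<in>S. f i (Hilbert_Choice.inv p i)))"
    unfolding det_on_def by (rule sum_permutations_inverse)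
  also have "\<dots> = det_on S (\<lambda>i j. f j i)"
    unfolding det_on_def
  proof (intro sum.cong refl arg_cong2[where f = "(*)"] arg_cong[where f = of_int])
    fix p assume "p \<in> {p. p permutes S}"
    then have p: "p permutes S" by simp
    show "sign (Hilbert_Choice.inv p) = sign p"
      using assms p by (simp add: sign_inverse permutation_permutes exI[of _ S] permutes_imp_permutation)
    show "(\<Prod>i\<in>S. f i (Hilbert_Choice.inv p i)) = (\<Prod>i\<in>S. f (p i) i)"
      using prod.permutes_inv[OF p, of f] by simp
  qed
  finally show ?thesis ..
qed

text \<open>A permutation of \<open>T \<union> {s}\<close> that sends \<open>s\<close> to \<open>j\<close> is a permutation of \<open>T\<close> followed by the
transposition of \<open>s\<close> and \<open>j\<close>. Hence the cofactor at \<open>(s, j)\<close> is minus the determinant over \<open>T\<close>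
in which column \<open>s\<close> takes the place of column \<open>j\<close>. As the column keeps the label \<open>j\<close>, the sign
does not depend on any positions.\<close>

lemma det_on_row_expansion:
  fixes T :: "'b set" and f :: "'b \<Rightarrow> 'b \<Rightarrow> 'a :: comm_ring_1"
  assumes "finite T" "s \<notin> T"
  shows "det_on (insert s T) f =
    f s s * det_on T f - (\<Sum>j\<in>T. f s j * det_on T (\<lambda>k l. f k (if l = j then s else l)))"
proof -
  let ?P = "{q. q permutes T}"
  define trm where "trm p = of_int (sign p) * (\<Prod>i\<in>insert s T. f i (p i))" for p :: "'b \<Rightarrow> 'b"
  have fix_s: "q s = s" if "q \<in> ?P" for q
    using that assms(2) by (auto simp: permutes_def)
  have diagonal: "(\<Sum>q\<in>?P. trm (transpose s s \<circ> q)) = f s s * det_on T f"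
    unfolding det_on_def sum_distrib_left
  proof (intro sum.cong refl)
    fix q assume "q \<in> ?P"
    then show "trm (transpose s s \<circ> q) = f s s * (of_int (sign q) * (\<Prod>i\<in>T. f i (q i)))"
      using assms fix_s[of q] by (simp add: trm_def mult_ac)
  qed
  have off: "(\<Sum>q\<in>?P. trm (transpose s j \<circ> q)) =
      - (f s j * det_on T (\<lambda>k l. f k (if l = j then s else l)))" if j: "j \<in> T" for j
  proof -
    have "trm (transpose s j \<circ> q) =
        - (f s j * (of_int (sign q) * (\<Prod>i\<in>T. f i (if q i = j then s else q i))))"
      if q: "q \<in> ?P" for q
    proof -
      have "s \<noteq> j" using j assms(2) by auto
      moreover have "permutation q"
        using q assms(1) by (auto intro: permutes_imp_permutation)
      ultimately have "sign (transpose s j \<circ> q) = - sign q"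
        by (simp add: sign_compose sign_swap_id permutation_swap_id)
      moreover have "(\<Prod>i\<in>T. f i (transpose s j (q i))) =
          (\<Prod>i\<in>T. f i (if q i = j then s else q i))"
      proof (rule prod.cong)
        fix i assume "i \<in> T"
        then have "q i \<in> T" using q by (simp add: permutes_in_image)
        then have "q i \<noteq> s" using assms(2) by auto
        then show "f i (transpose s j (q i)) = f i (if q i = j then s else q i)"
          by (auto simp: transpose_def)
      qed simp
      ultimately show ?thesis
        using assms fix_s[OF q] by (simp add: trm_def mult_ac)
    qed
    then show ?thesis
      by (simp add: det_on_def sum_distrib_left flip: sum_negf)
  qed
  have "det_on (insert s T) f = (\<Sum>b\<in>insert s T. \<Sum>q\<in>?P. trm (transpose s b \<circ> q))"
    unfolding det_on_def trm_def[symmetric] by (rule sum_over_permutations_insert[OF assms])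
  also have "\<dots> = f s s * det_on T f +
      (\<Sum>j\<in>T. - (f s j * det_on T (\<lambda>k l. f k (if l = j then s else l))))"
    using assms diagonal off by simp
  finally show ?thesis by (simp add: sum_negf)
qed

lemma det_on_column_expansion:
  assumes "finite T" "s \<notin> T"
  shows "det_on (insert s T) f =
    f s s * det_on T f - (\<Sum>i\<in>T. f i s * det_on T (\<lambda>k l. f (if k = i then s else k) l))"
proof -
  have "det_on (insert s T) f = det_on (insert s T) (\<lambda>k l. f l k)"
    using assms by (intro det_on_transpose[symmetric]) simp
  also have "\<dots> = f s s * det_on T (\<lambda>k l. f l k) -
      (\<Sum>i\<in>T. f i s * det_on T (\<lambda>k l. f (if l = i then s else l) k))"
    using assms by (rule det_on_row_expansion)
  also have "det_on T (\<lambda>k l. f l k) = det_on T f"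
    using assms(1) by (rule det_on_transpose)
  also have "(\<lambda>i. det_on T (\<lambda>k l. f (if l = i then s else l) k)) =
      (\<lambda>i. det_on T (\<lambda>k l. f (if k = i then s else k) l))"
    using det_on_transpose[OF assms(1)] by (intro ext)
  finally show ?thesis .
qed

section \<open>Almost principal minors\<close>

text \<open>The minor with rows \<open>T \<union> {r}\<close> and columns \<open>T \<union> {c}\<close>. Row \<open>r\<close> is given the label \<open>c\<close>, which
fixes the sign of the minor: the entry \<open>y r c\<close> counts as a diagonal entry.\<close>

definition minor :: "('b \<Rightarrow> 'b \<Rightarrow> 'a :: comm_ring_1) \<Rightarrow> 'b set \<Rightarrow> 'b \<Rightarrow> 'b \<Rightarrow> 'a" where
  "minor y T r c = det_on (insert c T) (\<lambda>k l. y (if k = c then r else k) l)"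

lemma minor_same: "minor y T r r = det_on (insert r T) y"
  by (auto simp: minor_def intro!: det_on_cong)

text \<open>Expansion along row \<open>r\<close>, followed by expansion along column \<open>c\<close> of what remains. After the
removal of row \<open>r\<close> and column \<open>j\<close>, the entry at \<open>(j, c)\<close> is on the diagonal and leaves a principal
minor; an entry at \<open>(i, c)\<close> with \<open>i \<noteq> j\<close> leaves rows \<open>T - {i}\<close> and columns \<open>T - {j}\<close>.\<close>

lemma minor_expansion:
  assumes "finite T" "c \<notin> T"
  shows "minor y T r c = y r c * det_on T y - (\<Sum>j\<in>T. y r j * y j c * det_on (T - {j}) y)
    + (\<Sum>j\<in>T. \<Sum>i\<in>T - {j}. y r j * y i c * minor y (T - {i, j}) j i)"
proof -
  have col: "det_on T (\<lambda>k l. y (if k = c then r else k) (if l = j then c else l)) =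
      y j c * det_on (T - {j}) y - (\<Sum>i\<in>T - {j}. y i c * minor y (T - {i, j}) j i)"
    (is "det_on T ?g = _") if j: "j \<in> T" for j
  proof -
    have "det_on T ?g = det_on (insert j (T - {j})) ?g"
      using j by (simp add: insert_absorb)
    also have "\<dots> = ?g j j * det_on (T - {j}) ?g
        - (\<Sum>i\<in>T - {j}. ?g i j * det_on (T - {j}) (\<lambda>k l. ?g (if k = i then j else k) l))"
      using assms by (intro det_on_column_expansion) auto
    also have "?g j j = y j c"
      using j assms by auto
    also have "det_on (T - {j}) ?g = det_on (T - {j}) y"
      using assms by (intro det_on_cong) auto
    also have "(\<Sum>i\<in>T - {j}. ?g i j * det_on (T - {j}) (\<lambda>k l. ?g (if k = i then j else k) l)) =
        (\<Sum>i\<in>T - {j}. y i c * minor y (T - {i, j}) j i)"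
    proof (rule sum.cong)
      fix i assume i: "i \<in> T - {j}"
      then have T: "insert i (T - {i, j}) = T - {j}" by auto
      have "det_on (T - {j}) (\<lambda>k l. ?g (if k = i then j else k) l) = minor y (T - {i, j}) j i"
        unfolding minor_def T using i j assms by (intro det_on_cong) auto
      moreover have "?g i j = y i c" using i assms by auto
      ultimately show "?g i j * det_on (T - {j}) (\<lambda>k l. ?g (if k = i then j else k) l) =
          y i c * minor y (T - {i, j}) j i" by simp
    qed simp
    finally show ?thesis .
  qed
  have "minor y T r c = y r c * det_on T (\<lambda>k l. y (if k = c then r else k) l)
      - (\<Sum>j\<in>T. y r j * det_on T (\<lambda>k l. y (if k = c then r else k) (if l = j then c else l)))"
    unfolding minor_def using assms by (subst det_on_row_expansion) auto
  also have "det_on T (\<lambda>k l. y (if k = c then r else k) l) = det_on T y"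
    using assms by (intro det_on_cong) auto
  also have "(\<Sum>j\<in>T. y r j * det_on T (\<lambda>k l. y (if k = c then r else k) (if l = j then c else l))) =
      (\<Sum>j\<in>T. y r j * y j c * det_on (T - {j}) y)
      - (\<Sum>j\<in>T. \<Sum>i\<in>T - {j}. y r j * y i c * minor y (T - {i, j}) j i)"
    by (simp add: col right_diff_distrib sum_subtractf sum_distrib_left mult.assoc)
  finally show ?thesis by (simp add: algebra_simps)
qed

section \<open>Minors of alternating matrices of odd size\<close>

definition alternating :: "('b \<Rightarrow> 'b \<Rightarrow> 'a :: comm_ring_1) \<Rightarrow> bool" where
  "alternating y \<longleftrightarrow> (\<forall>i. y i i = 0) \<and> (\<forall>i j. y i j = - y j i)"

lemma sum_off_diagonal_swap:
  assumes "finite T"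
  shows "(\<Sum>j\<in>T. \<Sum>i\<in>T - {j}. h i j) = (\<Sum>j\<in>T. \<Sum>i\<in>T - {j}. h j i)"
proof -
  have "(\<Sum>j\<in>T. \<Sum>i | i \<in> T \<and> i \<noteq> j. h i j) = (\<Sum>j\<in>T. \<Sum>i | i \<in> T \<and> j \<noteq> i. h j i)"
    by (rule sum.swap_restrict[OF assms assms])
  moreover have "{i \<in> T. i \<noteq> j} = T - {j}" "{i \<in> T. j \<noteq> i} = T - {j}" for j
    by auto
  ultimately show ?thesis by simp
qed

lemma sum_off_diagonal_antisymmetric:
  fixes h :: "'b \<Rightarrow> 'b \<Rightarrow> 'a :: ab_group_add"
  assumes "finite T" "\<And>i j. i \<in> T \<Longrightarrow> j \<in> T \<Longrightarrow> i \<noteq> j \<Longrightarrow> h i j = - h j i"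
  shows "(\<Sum>j\<in>T. \<Sum>i\<in>T - {j}. h i j) = 0"
  using assms
proof (induction T rule: finite_induct)
  case (insert x T)
  have "(\<Sum>j\<in>T. \<Sum>i\<in>insert x T - {j}. h i j) = (\<Sum>j\<in>T. h x j + (\<Sum>i\<in>T - {j}. h i j))"
  proof (rule sum.cong)
    fix j assume j: "j \<in> T"
    then have "insert x T - {j} = insert x (T - {j})" using insert.hyps by auto
    then show "(\<Sum>i\<in>insert x T - {j}. h i j) = h x j + (\<Sum>i\<in>T - {j}. h i j)"
      using insert.hyps by simp
  qed simp
  also have "\<dots> = (\<Sum>j\<in>T. h x j)"
    unfolding sum.distrib by (subst insert.IH) (auto intro: insert.prems)
  also have "\<dots> = - (\<Sum>j\<in>T. h j x)"
    unfolding sum_negf[symmetric] using insert.hyps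
    by (intro sum.cong insert.prems) auto
  finally show ?case using insert.hyps by simp
qed simp

text \<open>The two claims carry each other. The usual argument, which compares the determinant with that of
the transpose, only shows that twice an odd principal minor vanishes. Here the principal minors of
smaller odd size drop out of the double expansion by induction, and the remaining double sum
inherits the antisymmetry of the smaller minors: exchanging \<open>r\<close> and \<open>c\<close> changes its sign, and for
\<open>r = c\<close> its terms cancel in pairs.\<close>

lemma even_minor_alternating:
  assumes "alternating y" "finite T" "even (card T)" "r \<notin> T" "c \<notin> T"
  shows "minor y T r r = 0 \<and> minor y T c r = - minor y T r c"
  using assms(2-)
proof (induction "card T" arbitrary: T r c rule: less_induct)
  case less
  have diag: "y i i = 0" and skew: "y i j = - y j i" for i j
    using assms(1) unfolding alternating_def by blast+
  have smaller: "card (T - {i, j}) < card T" "finite (T - {i, j})" "even (card (T - {i, j}))"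
    if "i \<in> T" "j \<in> T" "i \<noteq> j" for i j
  proof -
    show "card (T - {i, j}) < card T"
      using less.prems(1) that by (intro psubset_card_mono) auto
    show "finite (T - {i, j})" "even (card (T - {i, j}))"
      using less.prems that by (auto simp: card_Diff_subset)
  qed
  have odd_zero: "det_on (T - {j}) y = 0" if j: "j \<in> T" for j
  proof -
    have "odd (card (T - {j}))"
      using less.prems j card_Suc_Diff1[of T j] by (metis even_Suc)
    then have "T - {j} \<noteq> {}" by (metis card.empty even_zero)
    then obtain i where i: "i \<in> T - {j}" by blast
    then have "T - {j} = insert i (T - {i, j})" by auto
    then have "det_on (T - {j}) y = minor y (T - {i, j}) i i"
      by (simp only: minor_same)
    also have "\<dots> = 0"
      using i j by (intro less.hyps[THEN conjunct1] smaller) auto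
    finally show ?thesis .
  qed
  have anti: "minor y (T - {i, j}) i j = - minor y (T - {i, j}) j i"
    if "i \<in> T" "j \<in> T" "i \<noteq> j" for i j
    using that by (intro less.hyps[THEN conjunct2] smaller) auto
  have expand: "minor y T r c = y r c * det_on T y
      + (\<Sum>j\<in>T. \<Sum>i\<in>T - {j}. y r j * y i c * minor y (T - {i, j}) j i)"
    if "c \<notin> T" for r c
    using less.prems that by (simp add: minor_expansion odd_zero)
  have "(\<Sum>j\<in>T. \<Sum>i\<in>T - {j}. y r j * y i r * minor y (T - {i, j}) j i) = 0"
  proof (rule sum_off_diagonal_antisymmetric)
    fix i j assume ij: "i \<in> T" "j \<in> T" "i \<noteq> j"
    have "y r j * y i r = y r i * y j r"
      using skew[of i r] skew[of r j] by simp
    then show "y r j * y i r * minor y (T - {i, j}) j i = - (y r i * y j r * minor y (T - {j, i}) i j)"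
      using anti[OF ij] by (simp add: insert_commute)
  qed (use less.prems in simp)
  moreover have "(\<Sum>j\<in>T. \<Sum>i\<in>T - {j}. y c j * y i r * minor y (T - {i, j}) j i)
      = - (\<Sum>j\<in>T. \<Sum>i\<in>T - {j}. y r j * y i c * minor y (T - {i, j}) j i)"
  proof -
    have "(\<Sum>j\<in>T. \<Sum>i\<in>T - {j}. y c j * y i r * minor y (T - {i, j}) j i)
       = (\<Sum>j\<in>T. \<Sum>i\<in>T - {j}. y c i * y j r * minor y (T - {i, j}) i j)"
      using less.prems(1) sum_off_diagonal_swap[of T "\<lambda>i j. y c j * y i r * minor y (T - {i, j}) j i"]
      by (simp add: insert_commute)
    also have "\<dots> = (\<Sum>j\<in>T. \<Sum>i\<in>T - {j}. - (y r j * y i c * minor y (T - {i, j}) j i))"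
      by (intro sum.cong refl) (simp add: anti skew[of c] skew[of _ r])
    finally show ?thesis by (simp add: sum_negf)
  qed
  ultimately show ?case
    using less.prems by (simp add: expand diag skew[of c r])
qed

corollary det_on_alternating_odd:
  assumes "alternating y" "odd (card T)"
  shows "det_on T y = 0"
proof -
  have "T \<noteq> {}" "finite T"
    using assms(2) by (metis card.empty even_zero, metis card.infinite even_zero)
  then obtain i where i: "i \<in> T" by blast
  have "det_on T y = minor y (T - {i}) i i"
    using i by (simp add: minor_same insert_absorb)
  also have "\<dots> = 0"
    using assms i \<open>finite T\<close> by (intro even_minor_alternating[THEN conjunct1]) auto
  finally show ?thesis .
qed

section \<open>Pfaffians over an index set\<close>

definition matchings :: "nat set \<Rightarrow> nat set set set" where
  "matchings T = {\<mu>. partition_on T \<mu> \<and> (\<forall>e\<in>\<mu>. card e = 2)}"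

definition pf_on :: "(nat \<Rightarrow> nat \<Rightarrow> 'a :: comm_ring_1) \<Rightarrow> nat set \<Rightarrow> 'a" where
  "pf_on y T = (\<Sum>\<mu>\<in>matchings T. (- 1) ^ crossings \<mu> * (\<Prod>e\<in>\<mu>. y (Min e) (Max e)))"

lemma pfaffian_eq_pf_on: "pfaffian Z = pf_on (\<lambda>i j. Z $$ (i, j)) {0..<dim_row Z}"
  by (simp add: pfaffian_def pf_on_def perfect_matchings_def matchings_def)

lemma matchings_empty: "matchings {} = {{}}"
  by (auto simp: matchings_def partition_on_empty)

lemma pf_on_empty [simp]: "pf_on y {} = 1"
proof -
  have "crossings {} = 0" by (simp add: crossings_def case_prod_unfold)
  then show ?thesis by (simp add: pf_on_def matchings_empty)
qed

lemma finite_matchings: "finite T \<Longrightarrow> finite (matchings T)"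
  by (rule finite_subset[of _ "Pow (Pow T)"]) (auto simp: matchings_def partition_on_def)

lemma finite_matching: "finite T \<Longrightarrow> \<mu> \<in> matchings T \<Longrightarrow> finite \<mu>"
  by (rule finite_subset[of _ "Pow T"]) (auto simp: matchings_def partition_on_def)

lemma matching_Union: "\<mu> \<in> matchings T \<Longrightarrow> \<Union>\<mu> = T"
  by (simp add: matchings_def partition_on_def)

lemma matchings_insert_pair:
  assumes "j \<noteq> l" "j \<notin> \<Union>\<nu>" "l \<notin> \<Union>\<nu>"
  shows "insert {j, l} \<nu> \<in> matchings T \<longleftrightarrow> \<nu> \<in> matchings (T - {j, l}) \<and> {j, l} \<subseteq> T"
proof -
  have "disjnt {j, l} (\<Union>\<nu>)" using assms by (simp add: disjnt_def)
  from partition_on_insert[OF this, of T] show ?thesis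
    using assms(1) by (simp add: matchings_def) blast
qed

lemma bij_betw_matchings_insert:
  assumes "j \<notin> U"
  shows "bij_betw (\<lambda>(l, \<nu>). insert {j, l} \<nu>) (SIGMA l:U. matchings (U - {l})) (matchings (insert j U))"
  unfolding bij_betw_def
proof (intro conjI subset_antisym subsetI)
  let ?S = "SIGMA l:U. matchings (U - {l})"
  have fresh: "j \<notin> \<Union>\<nu>" "l \<notin> \<Union>\<nu>" if "(l, \<nu>) \<in> ?S" for l \<nu>
  proof -
    have "\<Union>\<nu> = U - {l}" using that by (auto intro!: matching_Union)
    then show "j \<notin> \<Union>\<nu>" "l \<notin> \<Union>\<nu>" using assms by simp_all
  qed
  show "inj_on (\<lambda>(l, \<nu>). insert {j, l} \<nu>) ?S"
  proof (rule inj_onI, clarify)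
    fix l \<nu> l' \<nu>'
    assume S: "l \<in> U" "\<nu> \<in> matchings (U - {l})" "l' \<in> U" "\<nu>' \<in> matchings (U - {l'})"
      and eq: "insert {j, l} \<nu> = insert {j, l'} \<nu>'"
    have f: "j \<notin> \<Union>\<nu>" "j \<notin> \<Union>\<nu>'"
      using S fresh(1)[of l \<nu>] fresh(1)[of l' \<nu>'] by simp_all
    have nu: "\<nu> = {e \<in> insert {j, l} \<nu>. j \<notin> e}" "\<nu>' = {e \<in> insert {j, l'} \<nu>'. j \<notin> e}"
      using f by auto
    have "{j, l} \<in> insert {j, l'} \<nu>'" using eq by blast
    then have "{j, l} = {j, l'}" using f(2) by auto
    then have "l = l'" by (auto simp: doubleton_eq_iff)
    moreover have "\<nu> = \<nu>'"
      by (subst nu(1), subst nu(2)) (simp only: eq)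
    ultimately show "l = l' \<and> \<nu> = \<nu>'" by simp
  qed
  fix \<mu>
  show "\<mu> \<in> matchings (insert j U)" if \<mu>: "\<mu> \<in> (\<lambda>(l, \<nu>). insert {j, l} \<nu>) ` ?S"
  proof -
    from \<mu> obtain l \<nu> where l: "\<mu> = insert {j, l} \<nu>" "(l, \<nu>) \<in> ?S" by auto
    have "insert j U - {j, l} = U - {l}" using assms by auto
    then show ?thesis
      using l(2) fresh[OF l(2)] assms unfolding l(1) by (subst matchings_insert_pair) auto
  qed
  show "\<mu> \<in> (\<lambda>(l, \<nu>). insert {j, l} \<nu>) ` ?S" if \<mu>: "\<mu> \<in> matchings (insert j U)"
  proof -
    have "j \<in> \<Union>\<mu>" using matching_Union[OF \<mu>] by simp
    then obtain e where e: "e \<in> \<mu>" "j \<in> e" by auto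
    have "card e = 2" using e(1) \<mu> by (simp add: matchings_def)
    then obtain l where l: "e = {j, l}" "j \<noteq> l"
      using e(2) by (metis card_2_iff doubleton_eq_iff insertE singletonD)
    define \<nu> where "\<nu> = \<mu> - {{j, l}}"
    have ins: "insert {j, l} \<nu> = \<mu>" using e l by (auto simp: \<nu>_def)
    have disj: "e' \<inter> {j, l} = {}" if "e' \<in> \<nu>" for e'
      using \<mu> that e(1) l(1) by (auto simp: matchings_def partition_on_def disjoint_def \<nu>_def)
    have "\<nu> \<in> matchings (insert j U - {j, l}) \<and> {j, l} \<subseteq> insert j U"
      using \<mu> l(2) disj unfolding ins[symmetric] by (subst (asm) matchings_insert_pair) auto
    moreover have "insert j U - {j, l} = U - {l}" using assms by auto
    ultimately have "(l, \<nu>) \<in> ?S" using l(2) by auto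
    then show ?thesis using ins by force
  qed
qed

text \<open>A pair of \<open>\<nu>\<close> crosses \<open>{p, q}\<close> if and only if exactly one of its elements lies strictly between
\<open>p\<close> and \<open>q\<close>. All other pairs have no or two elements there, so the number of new crossings has the
parity of the number of elements of \<open>V\<close> between \<open>p\<close> and \<open>q\<close>, whatever \<open>\<nu>\<close> is. This is what makes
the sign in the expansion of the Pfaffian a function of the removed pair only.\<close>

lemma crossings_insert:
  assumes V: "finite V" "\<nu> \<in> matchings V" and pq: "p < q" "p \<notin> V" "q \<notin> V"
  shows "even (crossings (insert {p, q} \<nu>)) \<longleftrightarrow> even (crossings \<nu> + card (V \<inter> {p<..<q}))"
proof -
  let ?Q = "\<lambda>\<mu>. {(i, j, k, l). i < j \<and> j < k \<and> k < l \<and> {i, k} \<in> \<mu> \<and> {j, l} \<in> \<mu>}"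
  let ?C = "{(u, v). u < v \<and> {u, v} \<in> \<nu> \<and> (u < p \<and> p < v \<and> v < q \<or> p < u \<and> u < q \<and> q < v)}"
  let ?D = "{e \<in> \<nu>. odd (card (e \<inter> {p<..<q}))}"
  let ?g = "\<lambda>(u, v). if u < p then (u, p, v, q) else (p, u, q, v)"
  have UN: "\<Union>\<nu> = V" using V(2) by (rule matching_Union)
  have fin: "finite \<nu>" using V by (rule finite_matching)
  have pair: "\<exists>u v. e = {u, v} \<and> u < v \<and> u \<in> V \<and> v \<in> V" if "e \<in> \<nu>" for e
  proof -
    have "card e = 2" using that V(2) by (simp add: matchings_def)
    then obtain u v where e: "e = {u, v}" "u \<noteq> v" by (auto simp: card_2_iff)
    have "u \<in> V" "v \<in> V" using that UN e(1) by auto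
    moreover have "u < v \<or> v < u" "e = {v, u}" using e by auto
    ultimately show ?thesis using e(1) by blast
  qed
  have notin: "p \<notin> e" "q \<notin> e" if "e \<in> \<nu>" for e
    using that UN pq by auto
  have crossing: "odd (card ({u, v} \<inter> {p<..<q})) \<longleftrightarrow>
      u < p \<and> p < v \<and> v < q \<or> p < u \<and> u < q \<and> q < v"
    if "u < v" "u \<in> V" "v \<in> V" for u v
  proof -
    have "u \<noteq> p" "u \<noteq> q" "v \<noteq> p" "v \<noteq> q" using that pq by auto
    then show ?thesis
      using that(1) pq(1) by (auto simp: Int_insert_left)
  qed
  have Q_fin: "finite (?Q \<nu>)"
  proof (rule finite_subset)
    show "?Q \<nu> \<subseteq> V \<times> V \<times> V \<times> V" using UN by auto
  qed (use V(1) in simp)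
  \<comment> \<open>The new quadruples are those in which one of the two crossing pairs is \<open>{p, q}\<close>; \<open>?g\<close> builds them from
    the other pair.\<close>
  have split: "?Q (insert {p, q} \<nu>) = ?Q \<nu> \<union> ?g ` ?C"
  proof (intro subset_antisym subsetI)
    fix x assume "x \<in> ?Q (insert {p, q} \<nu>)"
    then obtain i j k l where x: "x = (i, j, k, l)" "i < j" "j < k" "k < l"
      "{i, k} \<in> insert {p, q} \<nu>" "{j, l} \<in> insert {p, q} \<nu>" by auto
    consider "{i, k} \<in> \<nu>" "{j, l} \<in> \<nu>" | "{i, k} = {p, q}" "{j, l} \<in> \<nu>"
      | "{i, k} \<in> \<nu>" "{j, l} = {p, q}" | "{i, k} = {p, q}" "{j, l} = {p, q}"
      using x by blast
    then show "x \<in> ?Q \<nu> \<union> ?g ` ?C"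
    proof cases
      case 2
      then have "i = p" "k = q" using x pq(1) by (auto simp: doubleton_eq_iff)
      then have "x = ?g (j, l)" "(j, l) \<in> ?C" using x 2 by auto
      then show ?thesis by blast
    next
      case 3
      then have "j = p" "l = q" using x pq(1) by (auto simp: doubleton_eq_iff)
      then have "x = ?g (i, k)" "(i, k) \<in> ?C" using x 3 by auto
      then show ?thesis by blast
    qed (use x in \<open>auto simp: doubleton_eq_iff\<close>)
  next
    fix x assume "x \<in> ?Q \<nu> \<union> ?g ` ?C"
    then show "x \<in> ?Q (insert {p, q} \<nu>)"
      by (auto split: if_splits)
  qed
  have disj: "?Q \<nu> \<inter> ?g ` ?C = {}"
  proof (intro equals0I)
    fix x assume x: "x \<in> ?Q \<nu> \<inter> ?g ` ?C"
    then obtain u v where "x = (u, p, v, q) \<or> x = (p, u, q, v)"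
      by (auto split: if_splits)
    then have "{p, q} \<in> \<nu>" using x by auto
    then show False using notin by blast
  qed
  have "inj_on ?g ?C"
    by (auto simp: inj_on_def split: if_splits)
  moreover have "bij_betw (\<lambda>(u, v). {u, v}) ?C ?D"
    unfolding bij_betw_def
  proof
    show "inj_on (\<lambda>(u, v). {u, v}) ?C"
      by (auto simp: inj_on_def doubleton_eq_iff)
    show "(\<lambda>(u, v). {u, v}) ` ?C = ?D"
    proof (intro subset_antisym subsetI)
      fix e assume "e \<in> (\<lambda>(u, v). {u, v}) ` ?C"
      then obtain u v where uv: "e = {u, v}" "(u, v) \<in> ?C" by auto
      then have "u \<in> V" "v \<in> V" using UN by auto
      then show "e \<in> ?D" using uv crossing[of u v] by auto
    next
      fix e assume e: "e \<in> ?D"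
      then obtain u v where uv: "e = {u, v}" "u < v" "u \<in> V" "v \<in> V" using pair by blast
      then have "(u, v) \<in> ?C" using e crossing[of u v] by auto
      then show "e \<in> (\<lambda>(u, v). {u, v}) ` ?C" using uv by auto
    qed
  qed
  ultimately have card: "card (?g ` ?C) = card ?D" "finite (?g ` ?C)"
  proof -
    assume inj: "inj_on ?g ?C" and bij: "bij_betw (\<lambda>(u, v). {u, v}) ?C ?D"
    have "finite ?D" using fin by simp
    then have "finite ?C" using bij_betw_finite[OF bij] by (rule iffD2[rotated])
    then show "finite (?g ` ?C)" by (rule finite_imageI)
    show "card (?g ` ?C) = card ?D"
      unfolding card_image[OF inj] using bij by (rule bij_betw_same_card)
  qed
  have "card (V \<inter> {p<..<q}) = card (\<Union>e\<in>\<nu>. e \<inter> {p<..<q})"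
    by (rule arg_cong[of _ _ card]) (use UN in auto)
  also have "\<dots> = (\<Sum>e\<in>\<nu>. card (e \<inter> {p<..<q}))"
    using V(2) fin
    by (intro card_UN_disjoint) (auto simp: matchings_def partition_on_def disjoint_def)
  finally have "even (card (V \<inter> {p<..<q})) \<longleftrightarrow> even (card ?D)"
    using fin by (simp add: even_sum_iff)
  moreover have "crossings (insert {p, q} \<nu>) = crossings \<nu> + card ?D"
    unfolding crossings_def split using Q_fin card disj by (simp add: card_Un_disjoint)
  ultimately show ?thesis by simp
qed

lemma pf_on_expansion:
  assumes "finite U" "j \<notin> U"
  shows "pf_on y (insert j U) = (\<Sum>l\<in>U. (- 1) ^ card (U \<inter> {min j l<..<max j l}) *
    y (min j l) (max j l) * pf_on y (U - {l}))"
proof -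
  let ?F = "\<lambda>\<mu>. (- 1) ^ crossings \<mu> * (\<Prod>e\<in>\<mu>. y (Min e) (Max e))"
  have step: "?F (insert {j, l} \<nu>) = (- 1) ^ card (U \<inter> {min j l<..<max j l}) *
      y (min j l) (max j l) * ?F \<nu>" if l: "l \<in> U" and \<nu>: "\<nu> \<in> matchings (U - {l})" for l \<nu>
  proof -
    have UN: "\<Union>\<nu> = U - {l}" using \<nu> by (rule matching_Union)
    have "j \<noteq> l" using l assms(2) by auto
    then have pair: "{min j l, max j l} = {j, l}" "min j l < max j l"
      by (auto simp: min_def max_def)
    have between: "(U - {l}) \<inter> {min j l<..<max j l} = U \<inter> {min j l<..<max j l}"
      by auto
    have "even (crossings (insert {min j l, max j l} \<nu>)) \<longleftrightarrow>
        even (crossings \<nu> + card ((U - {l}) \<inter> {min j l<..<max j l}))"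
      using assms l \<nu> pair(2) by (intro crossings_insert) (auto simp: min_def max_def)
    then have "(- 1 :: 'a) ^ crossings (insert {j, l} \<nu>) =
        (- 1) ^ (crossings \<nu> + card (U \<inter> {min j l<..<max j l}))"
      unfolding pair between by (metis neg_one_even_power neg_one_odd_power)
    moreover have "{j, l} \<notin> \<nu>" using UN by auto
    moreover have "finite \<nu>" using assms \<nu> by (auto intro: finite_matching)
    ultimately show ?thesis by (simp add: power_add mult_ac)
  qed
  have "pf_on y (insert j U) = (\<Sum>(l, \<nu>)\<in>(SIGMA l:U. matchings (U - {l})). ?F (insert {j, l} \<nu>))"
    unfolding pf_on_def sum.reindex_bij_betw[OF bij_betw_matchings_insert[OF assms(2)], symmetric]
    by (simp add: case_prod_unfold)
  also have "\<dots> = (\<Sum>l\<in>U. \<Sum>\<nu>\<in>matchings (U - {l}). ?F (insert {j, l} \<nu>))"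
    using assms by (subst sum.Sigma) (auto intro: finite_matchings)
  also have "\<dots> = (\<Sum>l\<in>U. (- 1) ^ card (U \<inter> {min j l<..<max j l}) *
    y (min j l) (max j l) * pf_on y (U - {l}))"
    by (simp add: step pf_on_def sum_distrib_left)
  finally show ?thesis .
qed

text \<open>The expansion determines the Pfaffian by recursion and only mentions the order of the indices, so
the claim follows by induction, without transporting matchings and crossings along \<open>h\<close>.\<close>

lemma pf_on_relabel:
  assumes "finite T" "strict_mono_on T h"
  shows "pf_on y (h ` T) = pf_on (\<lambda>i j. y (h i) (h j)) T"
  using assms
proof (induction "card T" arbitrary: T rule: less_induct)
  case less
  show ?case
  proof (cases "T = {}")
    case False
    then obtain j U where T: "T = insert j U" "j \<notin> U" by (meson Set.set_insert ex_in_conv)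
    have inj: "inj_on h T" using less.prems(2) by (rule strict_mono_on_imp_inj_on)
    have less_iff: "h a < h b \<longleftrightarrow> a < b" if "a \<in> T" "b \<in> T" for a b
      using strict_mono_on_less[OF less.prems(2)] that by blast
    have fin: "finite U" using less.prems T by simp
    have "pf_on y (h ` T) = pf_on y (insert (h j) (h ` U))" by (simp add: T)
    also have "\<dots> = (\<Sum>l\<in>h ` U. (- 1) ^ card (h ` U \<inter> {min (h j) l<..<max (h j) l}) *
        y (min (h j) l) (max (h j) l) * pf_on y (h ` U - {l}))"
      using inj T fin by (intro pf_on_expansion) auto
    also have "\<dots> = (\<Sum>l\<in>U. (- 1) ^ card (h ` U \<inter> {min (h j) (h l)<..<max (h j) (h l)}) *
        y (min (h j) (h l)) (max (h j) (h l)) * pf_on y (h ` U - {h l}))"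
      using inj T by (subst sum.reindex) auto
    also have "\<dots> = (\<Sum>l\<in>U. (- 1) ^ card (U \<inter> {min j l<..<max j l}) *
        y (h (min j l)) (h (max j l)) * pf_on (\<lambda>i j. y (h i) (h j)) (U - {l}))"
    proof (intro sum.cong refl)
      fix l assume l: "l \<in> U"
      have mm: "min (h j) (h l) = h (min j l)" "max (h j) (h l) = h (max j l)"
        using less_iff[of j l] less_iff[of l j] l T by (auto simp: min_def max_def not_le not_less)
      have "min j l \<in> T" "max j l \<in> T" using l T by (auto simp: min_def max_def)
      then have "h ` U \<inter> {h (min j l)<..<h (max j l)} = h ` (U \<inter> {min j l<..<max j l})"
        using less_iff T by auto
      moreover have "inj_on h (U \<inter> {min j l<..<max j l})"
        using inj by (rule inj_on_subset) (auto simp: T)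
      moreover have "h ` U - {h l} = h ` (U - {l})"
        using inj l T by (auto simp: inj_on_def)
      moreover have "pf_on y (h ` (U - {l})) = pf_on (\<lambda>i j. y (h i) (h j)) (U - {l})"
      proof (rule less.hyps)
        show "card (U - {l}) < card T"
          using T less.prems(1) by (intro psubset_card_mono) auto
        show "strict_mono_on (U - {l}) h"
          using less.prems(2) by (rule monotone_on_subset) (auto simp: T)
      qed (use fin in simp)
      ultimately show "(- 1) ^ card (h ` U \<inter> {min (h j) (h l)<..<max (h j) (h l)}) *
          y (min (h j) (h l)) (max (h j) (h l)) * pf_on y (h ` U - {h l}) =
          (- 1) ^ card (U \<inter> {min j l<..<max j l}) *
          y (h (min j l)) (h (max j l)) * pf_on (\<lambda>i j. y (h i) (h j)) (U - {l})"
        by (simp add: mm card_image)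
    qed
    also have "\<dots> = pf_on (\<lambda>i j. y (h i) (h j)) T"
      unfolding T(1) using T(2) fin by (intro pf_on_expansion[symmetric]) auto
    finally show ?thesis .
  qed simp
qed

lemma pf_on_cong:
  assumes "finite T" "\<And>i j. i \<in> T \<Longrightarrow> j \<in> T \<Longrightarrow> y i j = z i j"
  shows "pf_on y T = pf_on z T"
  unfolding pf_on_def
proof (intro sum.cong refl arg_cong2[where f = "(*)"] prod.cong)
  fix \<mu> e assume \<mu>: "\<mu> \<in> matchings T" "e \<in> \<mu>"
  then have "e \<subseteq> T" "card e = 2" by (auto simp: matchings_def partition_on_def)
  then have "Min e \<in> T" "Max e \<in> T"
    using assms(1) by (metis Max_in Min_in card.empty finite_subset subsetD zero_neq_numeral)+
  then show "y (Min e) (Max e) = z (Min e) (Max e)" by (rule assms(2))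
qed

section \<open>Almost principal minors as products of Pfaffians\<close>

text \<open>For \<open>r \<notin> T\<close> this is, up to sign, the Pfaffian over \<open>T \<union> {r}\<close>, expanded along row \<open>r\<close>; the sign
is chosen such that \<open>r\<close> counts as the first index. Unlike the Pfaffian itself, it does not depend
on the position of \<open>r\<close> relative to \<open>T\<close>.\<close>

definition bordered_pf :: "(nat \<Rightarrow> nat \<Rightarrow> 'a :: comm_ring_1) \<Rightarrow> nat set \<Rightarrow> nat \<Rightarrow> 'a" where
  "bordered_pf y T r = (\<Sum>j\<in>T. (- 1) ^ card {x \<in> T. x < j} * y r j * pf_on y (T - {j}))"

text \<open>The sign between \<open>j\<close> and \<open>l\<close> in the expansion is the product of the signs of their positions.
For \<open>l < j\<close> the two differ by one more sign, since \<open>l\<close> itself lies below \<open>j\<close>; it is absorbed by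
\<open>y l j = - y j l\<close>.\<close>

lemma pf_on_insert_eq_bordered_pf:
  assumes "alternating y" "finite U" "j \<notin> U"
  shows "pf_on y (insert j U) = (- 1) ^ card {x \<in> U. x < j} * bordered_pf y U j"
proof -
  have "(- 1) ^ card (U \<inter> {min j l<..<max j l}) * y (min j l) (max j l) =
      (- 1) ^ card {x \<in> U. x < j} * ((- 1) ^ card {x \<in> U. x < l} * y j l)" if l: "l \<in> U" for l
  proof (cases "j < l")
    case True
    have "{x \<in> U. x < l} = {x \<in> U. x < j} \<union> (U \<inter> {j<..<l})"
      using True assms(3) by (auto simp: not_less order.order_iff_strict)
    then have "card {x \<in> U. x < l} = card {x \<in> U. x < j} + card (U \<inter> {j<..<l})"
      using assms(2) by (simp add: card_Un_disjoint disjoint_iff)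
    then show ?thesis
      using True by (simp add: min_def max_def power_add flip: mult.assoc power_mult_distrib)
  next
    case False
    then have lj: "l < j" using l assms(3) by (metis linorder_neqE_nat)
    have "{x \<in> U. x < j} = insert l ({x \<in> U. x < l} \<union> (U \<inter> {l<..<j}))"
      using lj l by auto
    then have "card {x \<in> U. x < j} = Suc (card {x \<in> U. x < l} + card (U \<inter> {l<..<j}))"
      using assms(2) by (simp add: card_Un_disjoint disjoint_iff)
    moreover have "y l j = - y j l"
      using assms(1) unfolding alternating_def by blast
    ultimately show ?thesis
      using lj by (simp add: min_def max_def power_add mult_ac flip: power_mult_distrib)
  qed
  then show ?thesis
    unfolding pf_on_expansion[OF assms(2,3)] bordered_pf_def sum_distrib_left
    by (intro sum.cong) (simp_all add: mult.assoc)
qed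

text \<open>Exactly one of the two ranks drops by one when \<open>i\<close> and \<open>j\<close> are removed: that of the larger
index.\<close>

lemma rank_parity:
  fixes i j :: nat
  assumes "finite T" "i \<in> T" "j \<in> T" "i \<noteq> j"
  shows "(- 1 :: 'a :: comm_ring_1) ^ card {x \<in> T - {i, j}. x < i} * (- 1) ^ card {x \<in> T - {i, j}. x < j} =
    - ((- 1) ^ card {x \<in> T. x < i} * (- 1) ^ card {x \<in> T. x < j})"
  using assms
proof (induction i j rule: linorder_wlog)
  case (le i j)
  then have "i < j" by simp
  then have "{x \<in> T. x < i} = {x \<in> T - {i, j}. x < i}"
    and j: "{x \<in> T. x < j} = insert i {x \<in> T - {i, j}. x < j}"
    using le by auto
  moreover have "card (insert i {x \<in> T - {i, j}. x < j}) = Suc (card {x \<in> T - {i, j}. x < j})"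
    using le by (intro card_insert_disjoint) auto
  ultimately show ?case by simp
qed (simp add: insert_commute mult.commute)

text \<open>By induction, the minors in the double expansion are products of \<open>bordered_pf\<close> over \<open>T - {i, j}\<close>,
hence up to sign products of the Pfaffians over \<open>T - {i}\<close> and \<open>T - {j}\<close>: for \<open>i = j\<close> a principal
minor of even size is the square of its Pfaffian. The terms with \<open>i = j\<close> and those with
\<open>i \<noteq> j\<close> then fit together to a full double sum over \<open>T \<times> T\<close>, which is the product.\<close>

proposition odd_minor_alternating:
  assumes "alternating y" "finite T" "odd (card T)" "r \<notin> T" "c \<notin> T"
  shows "minor y T r c = bordered_pf y T r * bordered_pf y T c"
  using assms(2-)
proof (induction "card T" arbitrary: T r c rule: less_induct)
  case less
  define s :: "nat \<Rightarrow> 'a" where "s j = (- 1) ^ card {x \<in> T. x < j}" for j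
  define P where "P j = pf_on y (T - {j})" for j
  define t :: "nat \<Rightarrow> nat \<Rightarrow> 'a" where "t i j = (- 1) ^ card {x \<in> T - {i, j}. x < j}" for i j
  have skew: "y i j = - y j i" for i j
    using assms(1) unfolding alternating_def by blast
  have s_square: "s j * s j = 1" and t_square: "t i j * t i j = 1" for i j
    by (simp_all add: s_def t_def flip: power_mult_distrib)
  have minor: "minor y (T - {i, j}) r c = bordered_pf y (T - {i, j}) r * bordered_pf y (T - {i, j}) c"
    if "i \<in> T" "j \<in> T" "i \<noteq> j" "r \<in> {i, j}" "c \<in> {i, j}" for i j r c
  proof (rule less.hyps)
    show "card (T - {i, j}) < card T"
      using less.prems(1) that by (intro psubset_card_mono) auto
    show "finite (T - {i, j})" using less.prems(1) by simp
    show "odd (card (T - {i, j}))"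
    proof -
      have "2 \<le> card T"
        using card_mono[of T "{i, j}"] less.prems(1) that by simp
      then show ?thesis using less.prems that by (simp add: card_Diff_subset)
    qed
  qed (use that in auto)
  \<comment> \<open>\<open>t i j\<close> is the sign that moves row \<open>j\<close> of the Pfaffian over \<open>T - {i}\<close> to the front.\<close>
  have bordered: "bordered_pf y (T - {i, j}) j = t i j * P i" if "i \<in> T" "j \<in> T" "i \<noteq> j" for i j
  proof -
    have "T - {i} = insert j (T - {i, j})" using that by auto
    then have "P i = t i j * bordered_pf y (T - {i, j}) j"
      using pf_on_insert_eq_bordered_pf[OF assms(1), of "T - {i, j}" j] less.prems(1)
      by (simp add: P_def t_def)
    then show ?thesis using t_square by (simp flip: mult.assoc)
  qed
  have principal: "det_on (T - {j}) y = P j * P j" if j: "j \<in> T" for j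
  proof (cases "T - {j} = {}")
    case True
    show ?thesis unfolding P_def True by simp
  next
    case False
    then obtain i where i: "i \<in> T" "i \<noteq> j" by blast
    then have "T - {j} = insert i (T - {i, j})" by auto
    then have "det_on (T - {j}) y = minor y (T - {i, j}) i i" by (simp only: minor_same)
    also have "\<dots> = (t j i * P j) * (t j i * P j)"
      using minor[of i j i i] bordered[of j i] i j by (simp add: insert_commute)
    also have "\<dots> = (t j i * t j i) * (P j * P j)" by (simp only: mult_ac)
    finally show ?thesis by (simp add: t_square)
  qed
  have off: "minor y (T - {i, j}) j i = - (s j * P j * (s i * P i))"
    if "i \<in> T" "j \<in> T" "i \<noteq> j" for i j
  proof -
    have "minor y (T - {i, j}) j i = (t i j * P i) * (t j i * P j)"
      using minor[of i j j i] bordered[of i j] bordered[of j i] that by (simp add: insert_commute)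
    also have "\<dots> = (t j i * t i j) * (P i * P j)" by (simp only: mult_ac)
    also have "t j i * t i j = - (s i * s j)"
      using rank_parity[of T i j, where 'a = 'a] less.prems(1) that
      by (simp add: s_def t_def insert_commute)
    finally show ?thesis by (simp add: mult_ac)
  qed
  have "minor y T r c = - (\<Sum>j\<in>T. y r j * y j c * det_on (T - {j}) y)
      + (\<Sum>j\<in>T. \<Sum>i\<in>T - {j}. y r j * y i c * minor y (T - {i, j}) j i)"
    using less.prems assms(1) by (simp add: minor_expansion det_on_alternating_odd)
  also have "(\<Sum>j\<in>T. y r j * y j c * det_on (T - {j}) y) =
      - (\<Sum>j\<in>T. (s j * y r j * P j) * (s j * y c j * P j))"
    unfolding sum_negf[symmetric]
  proof (intro sum.cong refl)
    fix j assume "j \<in> T"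
    have "(s j * y r j * P j) * (s j * y c j * P j) = (s j * s j) * (y r j * y c j * (P j * P j))"
      by (simp only: mult_ac)
    then show "y r j * y j c * det_on (T - {j}) y = - ((s j * y r j * P j) * (s j * y c j * P j))"
      using \<open>j \<in> T\<close> by (simp add: principal s_square skew[of j c])
  qed
  also have "(\<Sum>j\<in>T. \<Sum>i\<in>T - {j}. y r j * y i c * minor y (T - {i, j}) j i) =
      (\<Sum>j\<in>T. \<Sum>i\<in>T - {j}. (s j * y r j * P j) * (s i * y c i * P i))"
    by (intro sum.cong refl) (simp add: off skew[of _ c] mult_ac)
  also have "- (- (\<Sum>j\<in>T. (s j * y r j * P j) * (s j * y c j * P j))) +
      (\<Sum>j\<in>T. \<Sum>i\<in>T - {j}. (s j * y r j * P j) * (s i * y c i * P i)) =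
      (\<Sum>j\<in>T. \<Sum>i\<in>T. (s j * y r j * P j) * (s i * y c i * P i))"
    unfolding minus_minus sum.distrib[symmetric]
    by (intro sum.cong refl sum.remove[symmetric] less.prems(1))
  also have "\<dots> = bordered_pf y T r * bordered_pf y T c"
    by (simp add: bordered_pf_def s_def P_def sum_product)
  finally show ?case .
qed

section \<open>The determinant of an alternating matrix plus a rank-one matrix\<close>

lemma det_eq_det_on:
  assumes "A \<in> carrier_mat n n"
  shows "det A = det_on {0..<n} (\<lambda>i j. A $$ (i, j))"
  using det_def'[OF assms] by (simp add: det_on_def)

text \<open>Adding multiples of the border row to the rows of \<open>Y\<close> turns the border column into zero and
\<open>Y\<close> into \<open>Y + a b\<^sup>t\<close>.\<close>

lemma det_add_rank_one:
  fixes Y :: "'a :: comm_ring_1 mat"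
  assumes Y: "Y \<in> carrier_mat m m"
  shows "det (Y + mat m m (\<lambda>(i, j). a $ i * b $ j)) =
    det (four_block_mat Y (mat m 1 (\<lambda>(i, _). - a $ i)) (mat 1 m (\<lambda>(_, j). b $ j)) (1\<^sub>m 1))"
    (is "det ?S = det (four_block_mat Y ?A ?B ?I)")
proof -
  let ?L = "four_block_mat (1\<^sub>m m) ?A (0\<^sub>m 1 m) ?I"
  let ?R = "four_block_mat ?S (0\<^sub>m m 1) ?B ?I"
  have S: "?S \<in> carrier_mat m m" using Y by simp
  have L: "?L \<in> carrier_mat (m + 1) (m + 1)" and R: "?R \<in> carrier_mat (m + 1) (m + 1)"
    using S by auto
  have "?S + ?A * ?B = Y"
    using Y by (intro eq_matI) (auto simp: scalar_prod_def)
  then have "?L * ?R = four_block_mat Y ?A ?B ?I"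
    using S by (subst mult_four_block_mat[of _ m m _ 1 _ 1 _ _ m _ 1]) auto
  moreover have "det (?L * ?R) = det ?L * det ?R"
    using L R by (rule det_mult)
  moreover have "det ?L = 1"
  proof -
    have "det ?L = det (transpose_mat ?L)"
      using L by (rule det_transpose[symmetric])
    also have "transpose_mat ?L = four_block_mat (1\<^sub>m m) (0\<^sub>m m 1) (transpose_mat ?A) ?I"
      by (subst transpose_four_block_mat[of _ m m _ 1 _ 1]) auto
    also have "det \<dots> = 1"
      by (subst det_four_block_mat_upper_right_zero_col[of _ m]) auto
    finally show ?thesis .
  qed
  moreover have "det ?R = det ?S"
    using S by (subst det_four_block_mat_upper_right_zero_col[of _ m]) auto
  ultimately show ?thesis by simp
qed

lemma pfaffian_mat_delete:
  assumes "Y \<in> carrier_mat m m" "i < m"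
  shows "pfaffian (mat_delete Y i i) = pf_on (\<lambda>k l. Y $$ (k, l)) ({0..<m} - {i})"
proof -
  \<comment> \<open>\<open>h\<close> enumerates the indices other than \<open>i\<close> in increasing order.\<close>
  define h where "h k = (if k < i then k else Suc k)" for k
  have "h ` {0..<m - 1} = {0..<m} - {i}"
  proof (intro subset_antisym subsetI)
    fix k assume "k \<in> {0..<m} - {i}"
    then show "k \<in> h ` {0..<m - 1}"
      using assms(2) by (intro image_eqI[of _ _ "if k < i then k else k - 1"]) (auto simp: h_def)
  qed (use assms(2) in \<open>auto simp: h_def\<close>)
  moreover have "strict_mono_on {0..<m - 1} h"
    by (auto simp: strict_mono_on_def h_def)
  ultimately have "pf_on (\<lambda>k l. Y $$ (k, l)) ({0..<m} - {i}) = pf_on (\<lambda>k l. Y $$ (h k, h l)) {0..<m - 1}"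
    using pf_on_relabel[of "{0..<m - 1}" h] by simp
  also have "\<dots> = pf_on (\<lambda>k l. mat_delete Y i i $$ (k, l)) {0..<m - 1}"
    using assms by (intro pf_on_cong) (auto simp: mat_delete_def h_def)
  also have "\<dots> = pfaffian (mat_delete Y i i)"
    using assms by (simp add: pfaffian_eq_pf_on mat_delete_def)
  finally show ?thesis ..
qed

theorem proposition9:
  fixes Y :: "'a :: comm_ring_1 mat" and a b :: "'a vec" and m :: nat
  assumes "odd m"
    and "Y \<in> carrier_mat m m" and "skew_symmetric_mat Y"
    and "a \<in> carrier_vec m" and "b \<in> carrier_vec m"
  shows "det (Y + mat m m (\<lambda>(i, j). a $ i * b $ j)) =
           (\<Sum>i<m. (- 1) ^ i * a $ i * pfaffian (mat_delete Y i i)) *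
           (\<Sum>j<m. (- 1) ^ j * b $ j * pfaffian (mat_delete Y j j))"
proof -
  let ?T = "{0..<m}"
  \<comment> \<open>Index \<open>m\<close> carries \<open>a\<close> and index \<open>Suc m\<close> carries \<open>b\<close>. The entry at
    \<open>(Suc m, m)\<close> is the corner \<open>1\<close> of the bordered matrix.\<close>
  define y :: "nat \<Rightarrow> nat \<Rightarrow> 'a" where "y i j =
    (if i < m \<and> j < m then Y $$ (i, j)
     else if i = m \<and> j < m then a $ j else if i < m \<and> j = m then - a $ i
     else if i = Suc m \<and> j < m then b $ j else if i < m \<and> j = Suc m then - b $ i
     else if i = Suc m \<and> j = m then 1 else if i = m \<and> j = Suc m then - 1 else 0)" for i j
  have Y_skew: "Y $$ (i, j) = - Y $$ (j, i)" if "i < m" "j < m" for i j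
  proof -
    have "transpose_mat Y $$ (j, i) = (- Y) $$ (j, i)"
      using assms(3) by (simp add: skew_symmetric_mat_def)
    then show ?thesis using that assms(2) by simp
  qed
  have "alternating y"
    unfolding alternating_def
  proof (intro conjI allI)
    show "y i i = 0" for i
      using assms(2,3) by (auto simp: y_def skew_symmetric_mat_def)
    show "y i j = - y j i" for i j
    proof (cases "i < m \<and> j < m")
      case True
      then have eq: "y i j = Y $$ (i, j)" "y j i = Y $$ (j, i)" by (simp_all add: y_def)
      show ?thesis unfolding eq using True by (intro Y_skew) auto
    next
      case False
      then show ?thesis by (cases "i < m"; cases "j < m") (simp_all add: y_def)
    qed
  qed
  have bordered: "bordered_pf y ?T r = (\<Sum>j<m. (- 1) ^ j * v $ j * pfaffian (mat_delete Y j j))"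
    if "\<And>j. j < m \<Longrightarrow> y r j = v $ j" for r v
    unfolding bordered_pf_def atLeast0LessThan[symmetric]
  proof (intro sum.cong refl)
    fix j assume j: "j \<in> ?T"
    have "{x \<in> ?T. x < j} = {0..<j}" using j by auto
    moreover have "pf_on y (?T - {j}) = pfaffian (mat_delete Y j j)"
      using j assms(2)
      by (subst pfaffian_mat_delete) (auto simp: y_def intro!: pf_on_cong)
    ultimately show "(- 1) ^ card {x \<in> ?T. x < j} * y r j * pf_on y (?T - {j}) =
        (- 1) ^ j * v $ j * pfaffian (mat_delete Y j j)"
      using j that by simp
  qed
  have "det (Y + mat m m (\<lambda>(i, j). a $ i * b $ j)) =
      det_on {0..<Suc m} (\<lambda>i j. four_block_mat Y (mat m 1 (\<lambda>(i, _). - a $ i))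
        (mat 1 m (\<lambda>(_, j). b $ j)) (1\<^sub>m 1) $$ (i, j))"
    unfolding det_add_rank_one[OF assms(2)] using assms(2) by (intro det_eq_det_on) auto
  also have "\<dots> = minor y ?T (Suc m) m"
    unfolding minor_def using assms(2)
    by (subst atLeast0_lessThan_Suc, intro det_on_cong) (auto simp: y_def)
  also have "\<dots> = bordered_pf y ?T (Suc m) * bordered_pf y ?T m"
    using \<open>alternating y\<close> assms(1) by (intro odd_minor_alternating) auto
  also have "bordered_pf y ?T (Suc m) = (\<Sum>j<m. (- 1) ^ j * b $ j * pfaffian (mat_delete Y j j))"
    by (rule bordered) (simp add: y_def)
  also have "bordered_pf y ?T m = (\<Sum>i<m. (- 1) ^ i * a $ i * pfaffian (mat_delete Y i i))"
    by (rule bordered) (simp add: y_def)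
  finally show ?thesis by (simp add: mult.commute)
qed

end
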